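(* Let $m,n\ge 1$ be integers and let $A$ be a random real $m\times(m+n)$ matrix whose $m(m+n)$ entries have joint probability density $G(A)=f(\mathrm{tr}\,AA^T)$ with respect to the Cartesian (Lebesgue) measure, where $f:(0,\infty)\to[0,\infty)$ is a measurable function satisfying $$\int_0^\infty u^{\frac{m(m+n)}{2}-1}f(u)\,du=\frac{2}{S_{m(m+n)}}.$$ Partition the columns of $A$ into an $m\times m$ matrix $B$ (any $m$ chosen columns of $A$) and an $m\times n$ matrix $X$ (the remaining $n$ columns). Then the joint probability density of the $mn$ entries of the real random matrix $Z=B^{-1}X$ is independent of the function $f$ and is given by the universal function $$P(Z)=\frac{C}{\left[\det(\mathbf{1}+ZZ^T)\right]^{\frac{m+n}{2}}},$$ where $\mathbf 1$ is the $m\times m$ identity matrix and $C$ is a normalization constant (so that $\int P(Z)\,dZ=1$).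
   Context: $S_d=\frac{2\pi^{d/2}}{\Gamma(d/2)}$ denotes the surface area of the unit sphere embedded in $d$ dimensions. The Cartesian measure on real matrices is the product of the Lebesgue measures of all entries; e.g. $dA=\prod_{i,\alpha}dA_{i\alpha}$ and $dZ=\prod_{i,p}dZ_{ip}$. One has $\mathrm{tr}\,AA^T=\sum_{i,\alpha}A_{i\alpha}^2=\mathrm{tr}\,BB^T+\mathrm{tr}\,XX^T$. The integral condition on $f$ is equivalent to $\int G(A)\,dA=1$. "Independent of $f$" means that the same density, with the same constant $C$ depending only on $m$ and $n$, is obtained for every admissible $f$. *)

theory Defs
  imports "HOL-Probability.Probability"
begin

(* Surface area of the unit sphere embedded in d dimensions. *)
definition sphere_area :: "nat \<Rightarrow> real" where
  "sphere_area d = 2 * pi powr (real d / 2) / Gamma (real d / 2)"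

definition select_columns :: "('j \<Rightarrow> 'k) \<Rightarrow> 'a ^ 'k ^ 'm \<Rightarrow> 'a ^ 'j ^ 'm" where
  "select_columns p A = (\<chi> i j. A $ i $ p j)"

(* The admissible radial profiles for matrices with N entries. Only the values of f on
   (0, \<infinity>) are constrained; the value f 0 affects the density A \<mapsto> f (tr A A^T)
   on a null set only. *)
definition admissible_profile :: "nat \<Rightarrow> (real \<Rightarrow> real) \<Rightarrow> bool" where
  "admissible_profile N f \<longleftrightarrow>
     set_borel_measurable borel {0<..} f \<and>
     (\<forall>u>0. 0 \<le> f u) \<and>
     (\<integral>\<^sup>+u\<in>{0<..}. ennreal (u powr (real N / 2 - 1) * f u) \<partial>lborel)
       = ennreal (2 / sphere_area N)"

end

theory Submission
  imports Defs
begin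

text \<open>
  Write \<open>A = (B, X)\<close> and let \<open>h\<close> be a test function on the quotient \<open>Z = B\<^sup>-\<^sup>1 X\<close>. The integral of
  \<open>h Z * f (tr B B\<^sup>T + tr X X\<^sup>T)\<close> over \<open>B\<close> and \<open>X\<close> becomes, after the substitution \<open>X = B Z\<close> with Jacobian
  \<open>\<bar>det B\<bar>\<^sup>n\<close>, the integral of \<open>h Z * \<bar>det B\<bar>\<^sup>n * f (tr (B S B\<^sup>T))\<close> over \<open>B\<close> and \<open>Z\<close>, where
  \<open>S = 1 + Z Z\<^sup>T\<close>. As \<open>S\<close> is positive definite, there is \<open>V\<close> with \<open>V\<^sup>T S V = 1\<close>; substituting
  \<open>B = C V\<^sup>T\<close> removes \<open>S\<close> from the argument of \<open>f\<close> at the price of the factor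
  \<open>\<bar>det V\<bar>\<close> to the power \<open>m + n\<close>, which is \<open>(det S)\<close> to the power \<open>- (m + n) / 2\<close>. Hence the integral
  splits as (a number depending on \<open>f\<close>) times (the integral of \<open>h\<close> against the universal weight). This is
  \<open>nn_integral_matrix_quotient\<close>. For a probability density \<open>f (tr A A\<^sup>T)\<close> total mass 1 forces the number
  to be the reciprocal of the integral of the weight, so it is the same for all \<open>f\<close>.

  The integral of the weight must also be finite and nonzero; finiteness follows from the same
  formula applied to the indicator of the unit ball in place of \<open>f\<close>
  (\<open>nn_integral_gram_weight_finite\<close>).

  Three facts about Lebesgue measure on matrices carry the argument: the Jacobians of left and right
  multiplication (\<open>nn_integral_matrix_mult_left\<close>, \<open>nn_integral_matrix_mult_right\<close>), the nullity of the
  singular matrices (\<open>AE_lborel_det_nonzero\<close>), and the compatibility with splitting the columns into two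
  blocks (\<open>distr_lborel_select_columns\<close>).
\<close>

section \<open>Measurability\<close>

lemma continuous_on_matrix_mult [continuous_intros]:
  fixes f :: "'a::topological_space \<Rightarrow> real^'k^'m" and g :: "'a \<Rightarrow> real^'n^'k"
  assumes "continuous_on S f" "continuous_on S g"
  shows "continuous_on S (\<lambda>x. f x ** g x)"
  unfolding matrix_matrix_mult_def by (intro continuous_intros assms)

lemma continuous_on_transpose [continuous_intros]:
  fixes f :: "'a::topological_space \<Rightarrow> real^'k^'m"
  assumes "continuous_on S f"
  shows "continuous_on S (\<lambda>x. transpose (f x))"
  unfolding transpose_def by (intro continuous_intros assms)

lemma continuous_on_det [continuous_intros]:
  fixes f :: "'a::topological_space \<Rightarrow> real^'k^'k"
  assumes "continuous_on S f"
  shows "continuous_on S (\<lambda>x. det (f x))"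
  unfolding det_def by (intro continuous_intros assms)

lemma borel_measurable_matrix_mult [measurable (raw)]:
  fixes f :: "'a \<Rightarrow> real^'k^'m" and g :: "'a \<Rightarrow> real^'n^'k"
  assumes "f \<in> borel_measurable M" "g \<in> borel_measurable M"
  shows "(\<lambda>x. f x ** g x) \<in> borel_measurable M"
  using assms by (rule borel_measurable_continuous_Pair) (intro continuous_intros)

lemma borel_measurable_transpose [measurable (raw)]:
  fixes f :: "'a \<Rightarrow> real^'k^'m"
  assumes "f \<in> borel_measurable M"
  shows "(\<lambda>x. transpose (f x)) \<in> borel_measurable M"
  by (rule borel_measurable_continuous_on[OF _ assms]) (intro continuous_intros)

lemma borel_measurable_det [measurable (raw)]:
  fixes f :: "'a \<Rightarrow> real^'k^'k"
  assumes "f \<in> borel_measurable M"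
  shows "(\<lambda>x. det (f x)) \<in> borel_measurable M"
  by (rule borel_measurable_continuous_on[OF _ assms]) (intro continuous_intros)

section \<open>Lebesgue measure under coordinate maps and shears\<close>

text \<open>
  Maps that only rename coordinates pull boxes back to boxes with the same side lengths. This is
  stated for two different Euclidean spaces because it identifies matrices with their transposes
  and with pairs of column blocks.
\<close>

lemma distr_lborel_permute_Basis:
  fixes T :: "'a::euclidean_space \<Rightarrow> 'b::euclidean_space"
  assumes [measurable]: "T \<in> borel_measurable borel"
    and g: "bij_betw g Basis Basis"
    and Tg: "\<And>x b. b \<in> Basis \<Longrightarrow> T x \<bullet> b = x \<bullet> g b"
  shows "distr lborel borel T = lborel"
proof (rule lborel_eqI[symmetric])
  fix l u :: 'b
  assume le: "\<And>b. b \<in> Basis \<Longrightarrow> l \<bullet> b \<le> u \<bullet> b"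
  \<comment> \<open>The point whose coordinate at \<open>g b\<close> is the coordinate of \<open>y\<close> at \<open>b\<close>; it transports the corners.\<close>
  define lift where "lift y = (\<Sum>b\<in>Basis. (y \<bullet> b) *\<^sub>R g b)" for y :: 'b
  have gB: "g b \<in> Basis" if "b \<in> Basis" for b
    using g that by (auto simp: bij_betw_def)
  have g_eq: "g b = g c \<longleftrightarrow> b = c" if "b \<in> Basis" "c \<in> Basis" for b c
    using g that by (auto simp: bij_betw_def inj_on_def)
  have lift: "lift y \<bullet> g b = y \<bullet> b" if "b \<in> Basis" for y b
  proof -
    have "lift y \<bullet> g b = (\<Sum>c\<in>Basis. if c = b then y \<bullet> c else 0)"
      unfolding lift_def inner_sum_left using that
      by (intro sum.cong) (auto simp: inner_Basis gB g_eq)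
    then show ?thesis using that by simp
  qed
  have ball: "(\<forall>e\<in>Basis. Q e) \<longleftrightarrow> (\<forall>b\<in>Basis. Q (g b))" for Q
    using g unfolding bij_betw_def by (metis imageE imageI)
  have pre: "T -` box l u = box (lift l) (lift u)"
    by (auto simp: mem_box ball lift Tg)
  have le': "\<forall>e\<in>Basis. lift l \<bullet> e \<le> lift u \<bullet> e"
    unfolding ball using le by (simp add: lift)
  have "emeasure (distr lborel borel T) (box l u) = emeasure lborel (box (lift l) (lift u))"
    by (simp add: emeasure_distr pre)
  also have "\<dots> = (\<Prod>e\<in>Basis. (lift u - lift l) \<bullet> e)"
    by (rule emeasure_lborel_box) (use le' in blast)
  also have "\<dots> = (\<Prod>b\<in>Basis. (u - l) \<bullet> b)"
    by (subst prod.reindex_bij_betw[OF g, symmetric])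
       (auto simp: inner_diff_left lift intro!: arg_cong[where f=ennreal] prod.cong)
  finally show "emeasure (distr lborel borel T) (box l u) = (\<Prod>b\<in>Basis. (u - l) \<bullet> b)" .
qed simp

text \<open>
  By Fubini the coordinate along \<open>a\<close> can be integrated first. Since \<open>\<psi>\<close> vanishes at \<open>a\<close>, on each line
  in direction \<open>a\<close> the shear is a translation, which one-dimensional Lebesgue measure ignores.
\<close>

lemma nn_integral_lborel_shear:
  fixes h :: "'a::euclidean_space \<Rightarrow> ennreal"
  assumes [measurable]: "h \<in> borel_measurable borel"
    and a: "a \<in> Basis" and lin: "linear \<psi>" and "\<psi> a = 0"
  shows "(\<integral>\<^sup>+x. h (x + \<psi> x *\<^sub>R a) \<partial>lborel) = (\<integral>\<^sup>+x. h x \<partial>lborel)"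
proof -
  interpret product_sigma_finite "\<lambda>_::'a. lborel :: real measure"
    by standard
  have [measurable]: "\<psi> \<in> borel_measurable borel"
    by (intro borel_measurable_continuous_onI linear_continuous_on)
       (use lin in \<open>simp add: linear_conv_bounded_linear\<close>)
  define B' where "B' = (Basis - {a} :: 'a set)"
  have B': "Basis = insert a B'" "finite B'" "a \<notin> B'"
    using a by (auto simp: B'_def)
  define emb where "emb f = (\<Sum>b\<in>Basis. f b *\<^sub>R b)" for f :: "'a \<Rightarrow> real"
  have emb_upd: "emb (f(a := y)) = (\<Sum>b\<in>B'. f b *\<^sub>R b) + y *\<^sub>R a" for f y
    unfolding emb_def B'(1) using B'(2,3)
    by (simp add: add.commute) (intro sum.cong, auto)
  have emb_meas[measurable]: "emb \<in> borel_measurable (\<Pi>\<^sub>M b\<in>Basis. lborel)"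
    unfolding emb_def[abs_def] by measurable
  have slices: "(\<integral>\<^sup>+x. k x \<partial>lborel) =
      (\<integral>\<^sup>+f. (\<integral>\<^sup>+y. k ((\<Sum>b\<in>B'. f b *\<^sub>R b) + y *\<^sub>R a) \<partial>lborel) \<partial>(\<Pi>\<^sub>M b\<in>B'. lborel))"
    if [measurable]: "k \<in> borel_measurable borel" for k :: "'a \<Rightarrow> ennreal"
  proof -
    have "(\<integral>\<^sup>+x. k x \<partial>lborel) = (\<integral>\<^sup>+f. k (emb f) \<partial>(\<Pi>\<^sub>M b\<in>Basis. lborel))"
      by (subst lborel_eq, subst nn_integral_distr) (use emb_meas in \<open>auto simp: emb_def[abs_def]\<close>)
    also have "\<dots> = (\<integral>\<^sup>+f. (\<integral>\<^sup>+y. k (emb (f(a := y))) \<partial>lborel) \<partial>(\<Pi>\<^sub>M b\<in>B'. lborel))"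
      unfolding B'(1)
      by (rule product_nn_integral_insert[OF B'(2,3)]) (use B'(1) emb_meas in simp)
    finally show ?thesis
      by (simp only: emb_upd)
  qed
  have transl: "(\<integral>\<^sup>+y. k (y + c) \<partial>lborel) = (\<integral>\<^sup>+y. k y \<partial>lborel)"
    if [measurable]: "k \<in> borel_measurable borel" for k :: "real \<Rightarrow> ennreal" and c
    using nn_integral_real_affine[of k 1 c] by (simp add: add.commute)
  have "(\<integral>\<^sup>+y. h ((s + y *\<^sub>R a) + \<psi> (s + y *\<^sub>R a) *\<^sub>R a) \<partial>lborel) = (\<integral>\<^sup>+y. h (s + y *\<^sub>R a) \<partial>lborel)" for s
  proof -
    have "(s + y *\<^sub>R a) + \<psi> (s + y *\<^sub>R a) *\<^sub>R a = s + (y + \<psi> s) *\<^sub>R a" for y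
      using \<open>\<psi> a = 0\<close> by (simp add: linear_add[OF lin] linear_cmul[OF lin] algebra_simps)
    then show ?thesis
      using transl[of "\<lambda>y. h (s + y *\<^sub>R a)" "\<psi> s"] by (simp only:) simp
  qed
  then show ?thesis
    by (simp add: slices)
qed

text \<open>
  The shears for the single indices commute: none of them changes a functional used by another.
  Their composition is the row operation on matrices, one shear for each column.
\<close>

lemma nn_integral_lborel_multi_shear:
  fixes h :: "'a::euclidean_space \<Rightarrow> ennreal"
  assumes h: "h \<in> borel_measurable borel"
    and F: "finite I" "\<And>i. i \<in> I \<Longrightarrow> a i \<in> Basis"
    and lin: "\<And>i. i \<in> I \<Longrightarrow> linear (\<psi> i)"
    and zero: "\<And>i j. i \<in> I \<Longrightarrow> j \<in> I \<Longrightarrow> \<psi> i (a j) = 0"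
  shows "(\<integral>\<^sup>+x. h (x + (\<Sum>i\<in>I. \<psi> i x *\<^sub>R a i)) \<partial>lborel) = (\<integral>\<^sup>+x. h x \<partial>lborel)"
  using F lin zero h
proof (induction I arbitrary: h rule: finite_induct)
  case (insert k I)
  note [measurable] = \<open>h \<in> borel_measurable borel\<close>
  have lk: "linear (\<psi> k)" using insert by simp
  have [measurable]: "\<psi> k \<in> borel_measurable borel"
    by (intro borel_measurable_continuous_onI linear_continuous_on)
       (use lk in \<open>simp add: linear_conv_bounded_linear\<close>)
  have "\<psi> k (x + (\<Sum>i\<in>I. \<psi> i x *\<^sub>R a i)) = \<psi> k x" for x
    using insert.prems by (simp add: linear_add[OF lk] linear_sum[OF lk] linear_cmul[OF lk])
  then have "(\<integral>\<^sup>+x. h (x + (\<Sum>i\<in>insert k I. \<psi> i x *\<^sub>R a i)) \<partial>lborel) =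
     (\<integral>\<^sup>+x. (\<lambda>y. h (y + \<psi> k y *\<^sub>R a k)) (x + (\<Sum>i\<in>I. \<psi> i x *\<^sub>R a i)) \<partial>lborel)"
    using insert.hyps by (simp add: algebra_simps)
  also have "\<dots> = (\<integral>\<^sup>+y. h (y + \<psi> k y *\<^sub>R a k) \<partial>lborel)"
    by (rule insert.IH) (use insert.prems in auto)
  also have "\<dots> = (\<integral>\<^sup>+x. h x \<partial>lborel)"
    by (rule nn_integral_lborel_shear) (use insert.prems in auto)
  finally show ?case .
qed simp

section \<open>Lebesgue measure on matrices under multiplication\<close>

lemma bij_betw_matrix_Basis:
  "bij_betw (\<lambda>(i, j). axis i (axis j 1)) UNIV (Basis :: (real^'n^'m) set)"
  by (auto simp: bij_betw_def inj_on_def axis_eq_axis Basis_vec_def)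

lemma matrix_Basis_cases:
  assumes "b \<in> (Basis :: (real^'n^'m) set)"
  obtains i j where "b = axis i (axis j 1)"
  using assms by (auto simp: Basis_vec_def)

lemma distr_lborel_transpose:
  "distr lborel borel (transpose :: real^'n^'m \<Rightarrow> real^'m^'n) = lborel"
proof (rule distr_lborel_permute_Basis[where g = transpose])
  have tr: "transpose (axis i (axis j (1::real))) = axis j (axis i 1)" for i :: "'c::finite" and j :: "'d::finite"
    by (auto simp: transpose_def axis_def vec_eq_iff)
  show "bij_betw transpose (Basis :: (real^'m^'n) set) (Basis :: (real^'n^'m) set)"
    by (rule bij_betwI[where g = transpose]) (auto elim!: matrix_Basis_cases simp: tr)
  show "transpose Z \<bullet> b = Z \<bullet> transpose b" if "b \<in> Basis" for Z :: "real^'n^'m" and b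
    using that by (elim matrix_Basis_cases) (simp add: tr inner_axis, simp add: transpose_def)
qed simp

lemma abs_det_row_swap:
  fixes \<tau> :: "'m::finite \<Rightarrow> 'm"
  assumes "\<tau> permutes UNIV"
  shows "\<bar>det (\<chi> i j. (mat 1 $ i $ \<tau> j :: real))\<bar> = 1"
proof -
  have "det (\<chi> i j. (mat 1 $ i $ \<tau> j :: real)) = of_int (sign \<tau>) * det (mat 1 :: real^'m^'m)"
    by (rule det_permute_columns[OF assms])
  then show ?thesis
    by (auto simp: sign_def)
qed

text \<open>
  The columns of \<open>Z\<close> are transformed independently, so the Jacobian is a power of the determinant.
  Both sides are multiplicative in \<open>B\<close>, which reduces the claim to elementary matrices: diagonal
  matrices rescale coordinates, row swaps rename them, and row additions are shears.
\<close>

lemma nn_integral_matrix_mult_left: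
  fixes B :: "real^'m^'m" and h :: "real^'n^'m \<Rightarrow> ennreal"
  assumes "det B \<noteq> 0" and "h \<in> borel_measurable borel"
  shows "(\<integral>\<^sup>+Z. h Z \<partial>lborel) = ennreal (\<bar>det B\<bar> ^ CARD('n)) * (\<integral>\<^sup>+Z. h (B ** Z) \<partial>lborel)"
proof -
  have "det B \<noteq> 0 \<longrightarrow> (\<forall>h \<in> borel_measurable borel.
      (\<integral>\<^sup>+Z. h Z \<partial>lborel) = ennreal (\<bar>det B\<bar> ^ CARD('n)) * (\<integral>\<^sup>+Z. h (B ** (Z::real^'n^'m)) \<partial>lborel))"
    (is "?P B")
  proof (induction B rule: induct_matrix_elementary)
    case mult: (1 A B)
    show ?case
    proof (intro impI ballI)
      fix h :: "real^'n^'m \<Rightarrow> ennreal"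
      assume [measurable]: "h \<in> borel_measurable borel" and "det (A ** B) \<noteq> 0"
      then have nz: "det A \<noteq> 0" "det B \<noteq> 0"
        by (auto simp: det_mul)
      have "(\<integral>\<^sup>+Z. h Z \<partial>lborel) = ennreal (\<bar>det A\<bar> ^ CARD('n)) * (\<integral>\<^sup>+Z. h (A ** Z) \<partial>lborel)"
        by (rule mult(1)[rule_format, OF nz(1)]) measurable
      also have "(\<integral>\<^sup>+Z. h (A ** Z) \<partial>lborel) =
          ennreal (\<bar>det B\<bar> ^ CARD('n)) * (\<integral>\<^sup>+Z. h (A ** (B ** Z)) \<partial>lborel)"
        by (rule mult(2)[rule_format, OF nz(2)]) measurable
      finally show "(\<integral>\<^sup>+Z. h Z \<partial>lborel) =
          ennreal (\<bar>det (A ** B)\<bar> ^ CARD('n)) * (\<integral>\<^sup>+Z. h (A ** B ** Z) \<partial>lborel)"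
        by (simp add: det_mul abs_mult power_mult_distrib ennreal_mult mult.assoc matrix_mul_assoc)
    qed
  next
    case zero_row: (2 A i)
    then show ?case
      using det_zero_row(2)[of i A] by (simp add: row_def vec_eq_iff)
  next
    case diagonal: (3 A)
    show ?case
    proof (intro impI ballI)
      fix h :: "real^'n^'m \<Rightarrow> ennreal"
      assume [measurable]: "h \<in> borel_measurable borel" and "det A \<noteq> 0"
      have det: "det A = (\<Prod>i\<in>UNIV. A$i$i)"
        by (rule det_diagonal) (rule diagonal)
      have row: "(A ** Z) $ i $ j = A$i$i * Z$i$j" for Z :: "real^'n^'m" and i j
      proof -
        have "(A ** Z) $ i $ j = (\<Sum>k\<in>UNIV. if k = i then A$i$i * Z$i$j else 0)"
          unfolding matrix_matrix_mult_def vec_lambda_beta by (rule sum.cong) (auto simp: diagonal)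
        then show ?thesis by simp
      qed
      define c where "c b = (A ** b) \<bullet> b" for b :: "real^'n^'m"
      have c: "c (axis i (axis j 1)) = A$i$i" for i j
        by (simp add: c_def inner_axis row)
      have nz: "c b \<noteq> 0" if "b \<in> Basis" for b
        using that \<open>det A \<noteq> 0\<close> by (auto simp: det c elim!: matrix_Basis_cases)
      have mult: "(**) A = (\<lambda>Z. 0 + (\<Sum>b\<in>Basis. (c b * (Z \<bullet> b)) *\<^sub>R b))"
        by (rule ext, rule euclidean_eqI) (auto simp: c inner_axis row elim!: matrix_Basis_cases)
      have "(\<Prod>b\<in>Basis. \<bar>c b\<bar>) = (\<Prod>(i, j)\<in>(UNIV :: ('m \<times> 'n) set). \<bar>A$i$i\<bar>)"
        by (subst prod.reindex_bij_betw[OF bij_betw_matrix_Basis, symmetric])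
           (simp add: case_prod_unfold c)
      also have "\<dots> = (\<Prod>i\<in>UNIV. \<Prod>j\<in>(UNIV::'n set). \<bar>A$i$i\<bar>)"
        by (subst prod.cartesian_product) simp
      also have "\<dots> = \<bar>det A\<bar> ^ CARD('n)"
        by (simp add: det abs_prod prod_power_distrib)
      finally have prod: "(\<Prod>b\<in>Basis. \<bar>c b\<bar>) = \<bar>det A\<bar> ^ CARD('n)" .
      have "lborel = density (distr lborel borel (\<lambda>Z::real^'n^'m. A ** Z)) (\<lambda>_. (\<Prod>b\<in>Basis. \<bar>c b\<bar>))"
        by (subst mult) (rule lborel_affine_euclidean, rule nz)
      then have "(\<integral>\<^sup>+Z. h Z \<partial>lborel) =
          (\<integral>\<^sup>+Z. h Z \<partial>density (distr lborel borel (\<lambda>Z::real^'n^'m. A ** Z)) (\<lambda>_. (\<Prod>b\<in>Basis. \<bar>c b\<bar>)))"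
        by simp
      then show "(\<integral>\<^sup>+Z. h Z \<partial>lborel) =
          ennreal (\<bar>det A\<bar> ^ CARD('n)) * (\<integral>\<^sup>+Z. h (A ** Z) \<partial>lborel)"
        by (simp add: nn_integral_density nn_integral_distr prod nn_integral_cmult)
    qed
  next
    case (4 m n)
    let ?\<tau> = "Transposition.transpose m n"
    let ?R = "\<chi> i j. (mat 1 $ i $ ?\<tau> j :: real)"
    have perm: "?\<tau> permutes UNIV"
      by (simp add: permutes_swap_id)
    have R: "?R ** Z = (\<chi> i. Z $ ?\<tau> i)" for Z :: "real^'n^'m"
    proof -
      have "(?R ** Z) $ i $ j = Z $ ?\<tau> i $ j" for i j
      proof -
        have "(?R ** Z) $ i $ j = (\<Sum>k\<in>UNIV. if k = ?\<tau> i then Z $ k $ j else 0)"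
          unfolding matrix_matrix_mult_def mat_def vec_lambda_beta
          by (rule sum.cong) (auto simp: transpose_eq_iff)
        then show ?thesis by simp
      qed
      then show ?thesis by (simp add: vec_eq_iff)
    qed
    let ?g = "\<lambda>b::real^'n^'m. \<chi> i. b $ ?\<tau> i"
    have swap_axis: "(\<chi> i. axis k v $ ?\<tau> i) = axis (?\<tau> k) v" for k and v :: "real^'n"
      by (auto simp: axis_def vec_eq_iff transpose_eq_iff)
    have distr: "distr lborel borel ?g = lborel"
    proof (rule distr_lborel_permute_Basis[where g = ?g])
      show "bij_betw ?g Basis Basis"
        by (rule bij_betwI[where g = ?g]) (auto elim!: matrix_Basis_cases simp: swap_axis)
      show "?g Z \<bullet> b = Z \<bullet> ?g b" if "b \<in> Basis" for Z b
        using that by (elim matrix_Basis_cases) (simp add: swap_axis inner_axis)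
      show "?g \<in> borel_measurable borel"
        unfolding R[symmetric] by measurable
    qed
    have [measurable]: "?g \<in> borel_measurable borel"
      unfolding R[symmetric] by measurable
    have swap: "(\<integral>\<^sup>+Z. h Z \<partial>lborel) = (\<integral>\<^sup>+Z. h (?g Z) \<partial>lborel)"
      if [measurable]: "h \<in> borel_measurable borel" for h
      by (subst distr[symmetric]) (simp add: nn_integral_distr)
    show ?case
      unfolding R abs_det_row_swap[OF perm] power_one ennreal_1 mult_1_left
      by (intro impI ballI swap)
  next
    case idplus: (5 m n c)
    let ?E = "\<chi> i j. (if i = m \<and> j = n then c else of_bool (i = j) :: real)"
    let ?\<psi> = "\<lambda>k Z. c * (Z::real^'n^'m) $ n $ k"
    have "?E = (\<chi> k. if k = m then row m (mat 1) + c *s row n (mat 1) else row k (mat 1))"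
      using idplus by (auto simp: vec_eq_iff row_def mat_def)
    then have det: "det ?E = 1"
      using det_row_operation[OF idplus, of "mat 1 :: real^'m^'m" c] by simp
    have E: "?E ** Z = Z + (\<Sum>k\<in>UNIV. ?\<psi> k Z *\<^sub>R axis m (axis k 1))" for Z
    proof -
      have "(?E ** Z) $ i $ j = (Z + (\<Sum>k\<in>UNIV. ?\<psi> k Z *\<^sub>R axis m (axis k 1))) $ i $ j" for i j
      proof -
        have "(?E ** Z) $ i $ j =
            (\<Sum>k\<in>UNIV. (if k = i then Z$i$j else 0) + (if k = n then if i = m then c * Z$n$j else 0 else 0))"
          unfolding matrix_matrix_mult_def vec_lambda_beta using idplus
          by (intro sum.cong) auto
        also have "\<dots> = Z$i$j + (if i = m then c * Z$n$j else 0)"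
          by (simp add: sum.distrib)
        also have "\<dots> = (Z + (\<Sum>k\<in>UNIV. ?\<psi> k Z *\<^sub>R axis m (axis k 1))) $ i $ j"
          by (simp add: axis_def if_distrib[of "\<lambda>v. v $ _"] if_distrib[of "\<lambda>x. _ * x"] cong: if_cong)
        finally show ?thesis .
      qed
      then show ?thesis by (simp add: vec_eq_iff)
    qed
    have axis_other: "axis m v $ n = 0" for v :: "real^'n"
      using idplus by (simp add: axis_def)
    have shear: "(\<integral>\<^sup>+Z. h (?E ** Z) \<partial>lborel) = (\<integral>\<^sup>+Z. h Z \<partial>lborel)"
      if "h \<in> borel_measurable borel" for h :: "real^'n^'m \<Rightarrow> ennreal"
      unfolding E
      by (rule nn_integral_lborel_multi_shear)
         (use that in \<open>auto intro!: linearI simp: algebra_simps axis_other\<close>)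
    show ?case
      unfolding det abs_one power_one ennreal_1 mult_1_left
      by (intro impI ballI shear[symmetric])
  qed
  with assms show ?thesis by blast
qed

lemma nn_integral_transpose:
  assumes [measurable]: "h \<in> borel_measurable borel"
  shows "(\<integral>\<^sup>+Z. h (transpose (Z :: real^'n^'m)) \<partial>lborel) = (\<integral>\<^sup>+Z. h Z \<partial>lborel)"
  by (subst distr_lborel_transpose[symmetric]) (simp add: nn_integral_distr)

lemma nn_integral_matrix_mult_right:
  fixes R :: "real^'n^'n" and h :: "real^'n^'m \<Rightarrow> ennreal"
  assumes "det R \<noteq> 0" and [measurable]: "h \<in> borel_measurable borel"
  shows "(\<integral>\<^sup>+Z. h Z \<partial>lborel) = ennreal (\<bar>det R\<bar> ^ CARD('m)) * (\<integral>\<^sup>+Z. h (Z ** R) \<partial>lborel)"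
proof -
  have "(\<integral>\<^sup>+Z. h Z \<partial>lborel) = (\<integral>\<^sup>+Y. h (transpose Y) \<partial>lborel)"
    by (rule nn_integral_transpose[symmetric]) measurable
  also have "\<dots> = ennreal (\<bar>det R\<bar> ^ CARD('m)) * (\<integral>\<^sup>+Y. h (transpose (transpose R ** Y)) \<partial>lborel)"
    using nn_integral_matrix_mult_left[of "transpose R" "\<lambda>Y. h (transpose Y)"] assms(1)
    by (simp add: det_transpose)
  also have "(\<integral>\<^sup>+Y. h (transpose (transpose R ** Y)) \<partial>lborel) = (\<integral>\<^sup>+Y. h (transpose Y ** R) \<partial>lborel)"
    by (simp add: matrix_transpose_mul)
  also have "\<dots> = (\<integral>\<^sup>+Z. h (Z ** R) \<partial>lborel)"
    by (rule nn_integral_transpose) measurable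
  finally show ?thesis .
qed

section \<open>Singular matrices\<close>

text \<open>
  The reversed polynomial \<open>det (1 + s B)\<close> has value 1 at \<open>s = 0\<close>, so it is visibly nonzero; away
  from 0 the shift \<open>t\<close> is a zero exactly when \<open>s = 1 / t\<close> is a root.
\<close>

lemma finite_det_shift_zeros:
  fixes B :: "real^'m^'m"
  shows "finite {t::real. det (B + t *\<^sub>R mat 1) = 0}"
proof -
  define q where "q = (\<Sum>p | p permutes (UNIV::'m set).
      of_int (sign p) * (\<Prod>i\<in>UNIV. [:mat 1 $ i $ p i, B $ i $ p i:]))"
  have q: "poly q s = det (mat 1 + s *\<^sub>R B)" for s
    by (simp add: q_def det_def poly_sum poly_prod)
  have "poly q 0 = 1"
    by (simp add: q)
  then have "q \<noteq> 0"
    by auto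
  then have "finite {s. poly q s = 0}"
    by (rule poly_roots_finite)
  moreover have "{t. det (B + t *\<^sub>R mat 1) = 0} \<subseteq> insert 0 (inverse ` {s. poly q s = 0})"
  proof safe
    fix t :: real
    assume zero: "det (B + t *\<^sub>R mat 1) = 0" and "t \<notin> inverse ` {s. poly q s = 0}"
    then have "poly q (inverse t) \<noteq> 0"
      by (metis (mono_tags, lifting) image_eqI inverse_inverse_eq mem_Collect_eq)
    moreover have "det (B + t *\<^sub>R mat 1) = t ^ CARD('m) * det (mat 1 + inverse t *\<^sub>R B)" if "t \<noteq> 0"
    proof -
      have "B + t *\<^sub>R mat 1 = (\<chi> i. t *s (mat 1 + inverse t *\<^sub>R B) $ i)"
        using that by (auto simp: vec_eq_iff algebra_simps)
      then show ?thesis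
        by (simp only: det_rows_mul vec_lambda_eta) simp
    qed
    ultimately show "t = 0"
      using zero by (auto simp: q)
  qed
  ultimately show ?thesis
    by (meson finite_imageI finite_insert finite_subset)
qed

text \<open>
  Let \<open>I\<close> be the measure of the singular matrices. Shifting by \<open>t\<close> times the identity preserves
  Lebesgue measure, so integrating over all real \<open>t\<close> gives \<open>\<infinity> * I\<close>; but each single matrix becomes
  singular for only finitely many \<open>t\<close>, so Fubini gives 0 for the same integral.
\<close>

lemma AE_lborel_det_nonzero:
  "AE B in lborel. det (B :: real^'m^'m) \<noteq> 0"
proof -
  define N where "N = {B :: real^'m^'m. det B = 0}"
  have [measurable]: "N \<in> sets borel"
    unfolding N_def by measurable
  define I where "I = (\<integral>\<^sup>+B. indicator N B \<partial>lborel :: ennreal)"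
  have "(\<integral>\<^sup>+t. I \<partial>(lborel :: real measure)) =
      (\<integral>\<^sup>+t. (\<integral>\<^sup>+B. indicator N (B + t *\<^sub>R mat 1) \<partial>lborel) \<partial>(lborel :: real measure))"
  proof (rule nn_integral_cong)
    fix t :: real
    show "I = (\<integral>\<^sup>+B. indicator N (B + t *\<^sub>R mat 1) \<partial>lborel)"
      unfolding I_def
      by (subst lborel_distr_plus[of "t *\<^sub>R mat 1", symmetric], subst nn_integral_distr)
         (auto simp: add.commute)
  qed
  also have "\<dots> = (\<integral>\<^sup>+B. (\<integral>\<^sup>+t. indicator N (B + t *\<^sub>R mat 1) \<partial>(lborel :: real measure)) \<partial>lborel)"
    by (rule lborel_pair.Fubini') measurable
  also have "\<dots> = (\<integral>\<^sup>+B. 0 \<partial>(lborel :: (real^'m^'m) measure))"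
  proof (rule nn_integral_cong)
    fix B :: "real^'m^'m"
    have "(\<integral>\<^sup>+t. indicator N (B + t *\<^sub>R mat 1) \<partial>(lborel :: real measure)) =
        (\<integral>\<^sup>+t. indicator {t. det (B + t *\<^sub>R mat 1) = 0} t \<partial>lborel)"
      by (auto simp: N_def indicator_def intro!: nn_integral_cong)
    also have "\<dots> = emeasure lborel {t. det (B + t *\<^sub>R mat 1) = 0}"
      by (rule nn_integral_indicator) measurable
    also have "\<dots> = 0"
      using finite_imp_null_set_lborel[OF finite_det_shift_zeros[of B]] by auto
    finally show "(\<integral>\<^sup>+t. indicator N (B + t *\<^sub>R mat 1) \<partial>(lborel :: real measure)) = 0" .
  qed
  finally have "I = 0"
    by (simp add: ennreal_mult_eq_top_iff ennreal_mult_top split: if_splits)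
  then have "N \<in> null_sets lborel"
    by (simp add: I_def null_sets_def)
  then show ?thesis
    by (rule AE_I') (auto simp: N_def)
qed

section \<open>Positive definite matrices are congruent to the identity\<close>

lemma inner_matrix_vector_symmetric:
  fixes S :: "real^'m^'m"
  assumes "transpose S = S"
  shows "x \<bullet> (S *v y) = y \<bullet> (S *v x)"
  by (metis assms dot_lmul_matrix inner_commute transpose_matrix_vector)

text \<open>
  The columns of \<open>V\<close> are an orthonormal basis for the inner product \<open>x \<bullet> (S *v y)\<close>. An orthonormal
  family indexed by a proper subset of the indices can always be enlarged, since fewer than \<open>CARD('m)\<close>
  linear conditions have a common nonzero solution.
\<close>

lemma positive_definite_congruent_identity:
  fixes S :: "real^'m^'m"
  assumes sym: "transpose S = S" and pos: "\<And>x. x \<noteq> 0 \<Longrightarrow> 0 < x \<bullet> (S *v x)"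
  obtains V :: "real^'m^'m" where "transpose V ** S ** V = mat 1"
proof -
  have "\<exists>v::'m \<Rightarrow> real^'m. \<forall>i\<in>J. \<forall>j\<in>J. v i \<bullet> (S *v v j) = of_bool (i = j)" for J
  proof (induction J rule: finite_induct[OF finite])
    case (2 k J)
    then obtain v where v: "\<And>i j. i \<in> J \<Longrightarrow> j \<in> J \<Longrightarrow> v i \<bullet> (S *v v j) = of_bool (i = j)"
      by blast
    \<comment> \<open>The conditions already imposed, padded with zeros to an endomorphism: coordinate \<open>k\<close> of the image is always 0.\<close>
    define L where "L w = (\<chi> i. if i \<in> J then v i \<bullet> (S *v w) else 0)" for w
    have L: "linear L"
      by (rule linearI)
         (auto simp: L_def vec_eq_iff matrix_vector_right_distrib matrix_vector_mult_scaleR inner_add_right)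
    have "L w \<noteq> axis k 1" for w
    proof
      assume "L w = axis k 1"
      then have "L w $ k = 1" by simp
      then show False using 2 by (simp add: L_def)
    qed
    then have "\<not> surj L"
      by (metis surjD)
    then have "\<not> inj L"
      using linear_injective_imp_surjective[OF L] by blast
    then obtain w where w: "w \<noteq> 0" "L w = 0"
      using linear_injective_0[OF L] by blast
    have orth: "v i \<bullet> (S *v w) = 0" if "i \<in> J" for i
      using arg_cong[OF w(2), of "\<lambda>x. x $ i"] that by (simp add: L_def)
    define u where "u = (1 / sqrt (w \<bullet> (S *v w))) *\<^sub>R w"
    have "u \<bullet> (S *v u) = 1"
      using pos[OF w(1)] by (simp add: u_def matrix_vector_mult_scaleR)
    moreover have "v i \<bullet> (S *v u) = 0" "u \<bullet> (S *v v i) = 0" if "i \<in> J" for i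
      using orth[OF that] inner_matrix_vector_symmetric[OF sym, of u "v i"]
      by (simp_all add: u_def matrix_vector_mult_scaleR)
    ultimately have "\<forall>i\<in>insert k J. \<forall>j\<in>insert k J.
        (v(k := u)) i \<bullet> (S *v (v(k := u)) j) = of_bool (i = j)"
      using v 2 by auto
    then show ?case by blast
  qed simp
  from this[of UNIV] obtain v :: "'m \<Rightarrow> real^'m"
    where v: "\<And>i j. v i \<bullet> (S *v v j) = of_bool (i = j)"
    by blast
  define V :: "real^'m^'m" where "V = (\<chi> i j. v j $ i)"
  have SV: "(S ** V) $ k $ j = (S *v v j) $ k" for k j
    by (simp add: V_def matrix_matrix_mult_def matrix_vector_mult_def)
  have tV: "transpose V $ i $ k = v i $ k" for i k
    by (simp add: V_def transpose_def)
  have "(transpose V ** (S ** V)) $ i $ j = v i \<bullet> (S *v v j)" for i j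
    by (subst matrix_matrix_mult_def) (simp add: SV tV inner_vec_def)
  then have "transpose V ** S ** V = mat 1"
    by (simp add: vec_eq_iff v mat_def matrix_mul_assoc[symmetric])
  then show ?thesis
    by (rule that)
qed

section \<open>Measurability of the inverse\<close>

lemma matrix_inv_mult:
  fixes A :: "real^'m^'m"
  assumes "det A \<noteq> 0"
  shows "A ** matrix_inv A = mat 1" "matrix_inv A ** A = mat 1"
proof -
  have "\<exists>A'. A ** A' = mat 1 \<and> A' ** A = mat 1"
    using assms invertible_det_nz[of A] by (simp add: invertible_def)
  then have "A ** matrix_inv A = mat 1 \<and> matrix_inv A ** A = mat 1"
    unfolding matrix_inv_def by (rule someI_ex)
  then show "A ** matrix_inv A = mat 1" "matrix_inv A ** A = mat 1"
    by auto
qed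

text \<open>
  Cramer's rule for each column exhibits the entries of the inverse as rational functions.
\<close>

lemma matrix_inv_cramer:
  fixes A :: "real^'m^'m"
  assumes "det A \<noteq> 0"
  shows "matrix_inv A = (\<chi> k c. det (\<chi> i j. if j = k then mat 1 $ i $ c else A $ i $ j) / det A)"
proof -
  have "A *v column c (matrix_inv A) = column c (mat 1)" for c
  proof -
    have "A *v column c (matrix_inv A) = column c (A ** matrix_inv A)"
      by (simp add: column_def matrix_vector_mult_def matrix_matrix_mult_def vec_eq_iff)
    then show ?thesis by (simp add: matrix_inv_mult assms)
  qed
  then have "column c (matrix_inv A) =
      (\<chi> k. det (\<chi> i j. if j = k then column c (mat 1) $ i else A $ i $ j) / det A)" for c
    using cramer[OF assms] by blast
  from this[unfolded column_def vec_lambda_beta] show ?thesis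
    by (simp add: vec_eq_iff)
qed

text \<open>
  On the open set of invertible matrices the inverse is continuous. On the complement
  \<open>matrix_inv\<close> is the choice from an empty set, hence one and the same matrix throughout.
\<close>

lemma borel_measurable_matrix_inv [measurable]:
  "(matrix_inv :: real^'m^'m \<Rightarrow> real^'m^'m) \<in> borel_measurable borel"
proof -
  define G where "G = {A :: real^'m^'m. det A \<noteq> 0}"
  define adj where
    "adj A = (\<chi> k c. det (\<chi> i j. if j = k then mat 1 $ i $ c else A $ i $ j) / det A)" for A :: "real^'m^'m"
  have "matrix_inv A = (if A \<in> G then adj A else (SOME A'. False))" for A :: "real^'m^'m"
  proof (cases "A \<in> G")
    case True
    then show ?thesis
      using matrix_inv_cramer[of A] by (simp add: G_def adj_def)
  next
    case False
    then have no_inv: "(A ** A' = mat 1 \<and> A' ** A = mat 1) = False" for A'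
      using invertible_det_nz[of A] by (auto simp: G_def invertible_def)
    show ?thesis
      by (simp only: matrix_inv_def no_inv False if_False)
  qed
  then have eq: "matrix_inv = (\<lambda>A. if A \<in> G then adj A else (SOME A'. False))"
    by (rule ext)
  have "continuous_on G (\<lambda>A. if j = k then mat 1 $ i $ c else A $ i $ j)" for i j k c :: 'm
    by (cases "j = k") (auto intro!: continuous_intros)
  then have "continuous_on G adj"
    unfolding adj_def by (intro continuous_intros) (auto simp: G_def)
  moreover have "G \<in> sets borel"
    unfolding G_def by measurable
  ultimately show ?thesis
    unfolding eq by (intro borel_measurable_continuous_on_if continuous_intros)
qed

section \<open>Integrating out the pivot block\<close>

lemma inner_matrix_eq_trace:
  "(A :: real^'n^'m) \<bullet> B = trace (A ** transpose B)"
  by (simp add: trace_def matrix_matrix_mult_def transpose_def inner_vec_def)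

lemma matrix_mult_add_left:
  fixes A B :: "real^'k^'m" and C :: "real^'n^'k"
  shows "(A + B) ** C = A ** C + B ** C"
  by (simp add: matrix_matrix_mult_def vec_eq_iff sum.distrib algebra_simps)

text \<open>
  The universal density before normalization.
\<close>

definition gram_weight :: "real^'n^'m \<Rightarrow> real" where
  "gram_weight Z = 1 / det (mat 1 + Z ** transpose Z) powr (real (CARD('m) + CARD('n)) / 2)"

text \<open>
  With \<open>S = 1 + Z Z\<^sup>T\<close> the quadratic form \<open>B \<mapsto> tr (B S B\<^sup>T)\<close> is the squared norm of \<open>(B, B Z)\<close>.
  Choosing \<open>V\<close> with \<open>V\<^sup>T S V = 1\<close>, the substitution \<open>B = C V\<^sup>T\<close> turns it into the squared norm of
  \<open>C\<close>, and \<open>(det V)\<^sup>2 * det S = 1\<close> makes the powers of \<open>det V\<close> produced by the substitution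
  functions of \<open>Z\<close> alone. Positivity of the weight comes from the same identity.
\<close>

lemma gram_normal_form:
  fixes Z :: "real^'n^'m"
  obtains V :: "real^'m^'m"
  where "\<And>C :: real^'m^'m. (C ** transpose V) \<bullet> (C ** transpose V) + (C ** transpose V ** Z) \<bullet> (C ** transpose V ** Z) = C \<bullet> C"
    and "det V \<noteq> 0"
    and "\<bar>det V\<bar> ^ (CARD('m) + CARD('n)) = gram_weight Z"
    and "0 < gram_weight Z"
proof -
  define S where "S = mat 1 + Z ** transpose Z"
  have sym: "transpose S = S"
    by (simp add: S_def matrix_transpose_mul transpose_def vec_eq_iff mat_def matrix_matrix_mult_def mult.commute)
  have pos: "0 < x \<bullet> (S *v x)" if "x \<noteq> 0" for x
  proof -
    have "x \<bullet> (S *v x) = x \<bullet> x + (transpose Z *v x) \<bullet> (transpose Z *v x)"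
      unfolding S_def matrix_vector_mult_add_rdistrib matrix_vector_mul_lid inner_add_right
      by (metis dot_lmul_matrix matrix_vector_mul_assoc transpose_matrix_vector)
    then show ?thesis
      using that by (simp add: add_pos_nonneg)
  qed
  obtain V :: "real^'m^'m" where V: "transpose V ** S ** V = mat 1"
    by (rule positive_definite_congruent_identity[OF sym pos])
  have det: "det V ^ 2 * det S = 1"
    using arg_cong[OF V, of det] by (simp add: det_mul power2_eq_square mult.commute mult.left_commute)
  then have nz: "det V \<noteq> 0"
    by auto
  have "det S = 1 / det V ^ 2"
    using det nz by (simp add: field_simps)
  also have "\<dots> = \<bar>det V\<bar> powr (- 2)"
    using nz by (simp add: powr_minus powr_numeral divide_inverse)
  finally have "det S powr (real (CARD('m) + CARD('n)) / 2) = \<bar>det V\<bar> powr - real (CARD('m) + CARD('n))"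
    by (simp add: powr_powr diff_divide_distrib)
  also have "\<dots> = inverse (\<bar>det V\<bar> ^ (CARD('m) + CARD('n)))"
    using nz by (subst powr_minus, subst powr_realpow) auto
  finally have w: "\<bar>det V\<bar> ^ (CARD('m) + CARD('n)) = gram_weight Z"
    by (simp add: gram_weight_def S_def inverse_eq_divide)
  have form: "B \<bullet> B + (B ** Z) \<bullet> (B ** Z) = trace (B ** S ** transpose B)" for B :: "real^'m^'m"
    by (simp add: inner_matrix_eq_trace S_def matrix_transpose_mul matrix_add_ldistrib
        matrix_mult_add_left trace_add matrix_mul_assoc)
  have "(C ** transpose V) \<bullet> (C ** transpose V) + (C ** transpose V ** Z) \<bullet> (C ** transpose V ** Z) = C \<bullet> C"
    for C :: "real^'m^'m"
  proof -
    have "C ** transpose V ** S ** transpose (C ** transpose V) = C ** (transpose V ** S ** V) ** transpose C"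
      by (simp add: matrix_transpose_mul matrix_mul_assoc)
    then show ?thesis
      unfolding form by (simp add: V inner_matrix_eq_trace)
  qed
  moreover have "0 < gram_weight Z"
    using nz by (simp flip: w)
  ultimately show ?thesis
    using that[of V] nz w by blast
qed

lemma gram_weight_pos: "0 < gram_weight Z"
  by (rule gram_normal_form[of Z])

lemma borel_measurable_gram_weight [measurable]:
  "gram_weight \<in> borel_measurable borel"
  unfolding gram_weight_def[abs_def] by measurable

text \<open>
  The integral over the square block that remains once \<open>Z\<close> has been separated off; it is the only
  place where the radial profile enters the law of \<open>Z\<close>. The first argument only carries the
  matrix size.
\<close>

definition radial_det_moment :: "'m::finite itself \<Rightarrow> nat \<Rightarrow> (real \<Rightarrow> ennreal) \<Rightarrow> ennreal" where
  "radial_det_moment _ n F = (\<integral>\<^sup>+B. ennreal (\<bar>det (B :: real^'m^'m)\<bar> ^ n) * F (B \<bullet> B) \<partial>lborel)"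

text \<open>
  Right multiplication by \<open>V\<^sup>T\<close> has Jacobian \<open>\<bar>det V\<bar>\<close> to the power \<open>CARD('m)\<close>, and \<open>\<bar>det B\<bar>\<close> contributes
  the remaining power \<open>CARD('n)\<close>; together they give the weight.
\<close>

lemma nn_integral_gram_fiber:
  fixes Z :: "real^'n^'m" and F :: "real \<Rightarrow> ennreal"
  assumes [measurable]: "F \<in> borel_measurable borel"
  shows "(\<integral>\<^sup>+B. ennreal (\<bar>det (B :: real^'m^'m)\<bar> ^ CARD('n)) * F (B \<bullet> B + (B ** Z) \<bullet> (B ** Z)) \<partial>lborel)
    = ennreal (gram_weight Z) * radial_det_moment TYPE('m) CARD('n) F"
proof -
  obtain V :: "real^'m^'m"
    where V: "\<And>C :: real^'m^'m. (C ** transpose V) \<bullet> (C ** transpose V) + (C ** transpose V ** Z) \<bullet> (C ** transpose V ** Z) = C \<bullet> C"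
    and nz: "det V \<noteq> 0" and w: "\<bar>det V\<bar> ^ (CARD('m) + CARD('n)) = gram_weight Z"
    using gram_normal_form[of Z] by metis
  have "(\<integral>\<^sup>+B. ennreal (\<bar>det (B :: real^'m^'m)\<bar> ^ CARD('n)) * F (B \<bullet> B + (B ** Z) \<bullet> (B ** Z)) \<partial>lborel)
    = ennreal (\<bar>det (transpose V)\<bar> ^ CARD('m)) *
      (\<integral>\<^sup>+C. ennreal (\<bar>det (C ** transpose V)\<bar> ^ CARD('n)) *
        F ((C ** transpose V) \<bullet> (C ** transpose V) + (C ** transpose V ** Z) \<bullet> (C ** transpose V ** Z)) \<partial>lborel)"
    by (rule nn_integral_matrix_mult_right) (use nz in \<open>auto simp: det_transpose\<close>)
  also have "\<dots> = ennreal (\<bar>det V\<bar> ^ CARD('m)) *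
      (\<integral>\<^sup>+C. ennreal (\<bar>det V\<bar> ^ CARD('n)) * (ennreal (\<bar>det (C :: real^'m^'m)\<bar> ^ CARD('n)) * F (C \<bullet> C)) \<partial>lborel)"
    unfolding V
    by (simp add: det_mul abs_mult power_mult_distrib ennreal_mult mult.assoc mult.left_commute)
  also have "\<dots> = ennreal (\<bar>det V\<bar> ^ CARD('m)) * ennreal (\<bar>det V\<bar> ^ CARD('n)) * radial_det_moment TYPE('m) CARD('n) F"
    by (simp add: nn_integral_cmult radial_det_moment_def mult.assoc)
  also have "ennreal (\<bar>det V\<bar> ^ CARD('m)) * ennreal (\<bar>det V\<bar> ^ CARD('n)) = ennreal (gram_weight Z)"
    by (simp flip: w add: power_add ennreal_mult)
  finally show ?thesis .
qed

text \<open>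
  For fixed invertible \<open>B\<close> substitute \<open>X = B Z\<close>, then exchange the integrals and integrate over
  \<open>B\<close> first. The result is a product: all dependence on \<open>F\<close> is in one factor and all dependence on
  \<open>h\<close> in the other. This is the universality.
\<close>

lemma nn_integral_matrix_quotient:
  fixes h :: "real^'n^'m \<Rightarrow> ennreal" and F :: "real \<Rightarrow> ennreal"
  assumes [measurable]: "h \<in> borel_measurable borel" "F \<in> borel_measurable borel"
  shows "(\<integral>\<^sup>+p. h (matrix_inv (fst p) ** snd p) * F (p \<bullet> p) \<partial>(lborel :: ((real^'m^'m) \<times> (real^'n^'m)) measure))
    = radial_det_moment TYPE('m) CARD('n) F * (\<integral>\<^sup>+Z. h Z * ennreal (gram_weight Z) \<partial>lborel)"
proof -
  let ?k = "\<lambda>B Z. ennreal (\<bar>det (B :: real^'m^'m)\<bar> ^ CARD('n)) * F (B \<bullet> B + (B ** Z) \<bullet> (B ** Z))"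
  have "(\<integral>\<^sup>+p. h (matrix_inv (fst p) ** snd p) * F (p \<bullet> p) \<partial>(lborel :: ((real^'m^'m) \<times> (real^'n^'m)) measure))
    = (\<integral>\<^sup>+B. (\<integral>\<^sup>+X. h (matrix_inv (B :: real^'m^'m) ** X) * F (B \<bullet> B + X \<bullet> X) \<partial>lborel) \<partial>lborel)"
    by (simp flip: lborel_prod add: inner_prod_def lborel.nn_integral_fst[symmetric])
  also have "\<dots> = (\<integral>\<^sup>+B. (\<integral>\<^sup>+Z. h Z * ?k B Z \<partial>lborel) \<partial>lborel)"
  proof (rule nn_integral_cong_AE)
    show "AE B in lborel. (\<integral>\<^sup>+X. h (matrix_inv B ** X) * F (B \<bullet> B + X \<bullet> X) \<partial>lborel) =
        (\<integral>\<^sup>+Z. h Z * ?k B Z \<partial>lborel)"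
      using AE_lborel_det_nonzero
    proof eventually_elim
      case (elim B)
      have "(\<integral>\<^sup>+X. h (matrix_inv B ** X) * F (B \<bullet> B + X \<bullet> X) \<partial>lborel) =
          ennreal (\<bar>det B\<bar> ^ CARD('n)) *
          (\<integral>\<^sup>+Z. h (matrix_inv B ** (B ** Z)) * F (B \<bullet> B + (B ** Z) \<bullet> (B ** Z)) \<partial>lborel)"
        by (rule nn_integral_matrix_mult_left[OF elim]) measurable
      also have "\<dots> = (\<integral>\<^sup>+Z. h Z * ?k B Z \<partial>lborel)"
        by (subst nn_integral_cmult[symmetric])
           (auto simp: matrix_mul_assoc matrix_inv_mult[OF elim] mult.left_commute)
      finally show ?case .
    qed
  qed
  also have "\<dots> = (\<integral>\<^sup>+Z. (\<integral>\<^sup>+B. h Z * ?k B Z \<partial>lborel) \<partial>lborel)"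
    by (rule lborel_pair.Fubini') measurable
  also have "\<dots> = (\<integral>\<^sup>+Z. radial_det_moment TYPE('m) CARD('n) F * (h Z * ennreal (gram_weight Z)) \<partial>lborel)"
    by (simp add: nn_integral_cmult nn_integral_gram_fiber mult_ac)
  also have "\<dots> = radial_det_moment TYPE('m) CARD('n) F * (\<integral>\<^sup>+Z. h Z * ennreal (gram_weight Z) \<partial>lborel)"
    by (rule nn_integral_cmult) measurable
  finally show ?thesis .
qed

text \<open>
  Testing the product formula with the indicator of the unit ball gives the finite volume of a ball
  on one side, and on the other the wanted integral times a positive factor.
\<close>

lemma nn_integral_gram_weight_finite:
  "(\<integral>\<^sup>+Z. ennreal (gram_weight (Z :: real^'n^'m)) \<partial>lborel) < \<infinity>"
proof -
  let ?F = "indicator {..<1} :: real \<Rightarrow> ennreal"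
  let ?E = "lborel :: ((real^'m^'m) \<times> (real^'n^'m)) measure"
  let ?I = "\<integral>\<^sup>+Z. ennreal (gram_weight (Z :: real^'n^'m)) \<partial>lborel"
  have ball: "?F (x \<bullet> x) = indicator (ball 0 1) x" for x :: "'a::euclidean_space"
    by (auto simp: indicator_def norm_eq_sqrt_inner)
  have nonzero: "radial_det_moment TYPE('m) CARD('n) ?F \<noteq> 0"
  proof
    assume "radial_det_moment TYPE('m) CARD('n) ?F = 0"
    then have "AE B in lborel. ennreal (\<bar>det (B :: real^'m^'m)\<bar> ^ CARD('n)) * ?F (B \<bullet> B) = 0"
      unfolding radial_det_moment_def by (subst (asm) nn_integral_0_iff_AE) auto
    then have "AE B in lborel. (B :: real^'m^'m) \<notin> ball 0 1"
      using AE_lborel_det_nonzero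
      by eventually_elim (auto simp: ball split: split_indicator_asm)
    then have "emeasure lborel (ball 0 1 :: (real^'m^'m) set) = 0"
      by (subst (asm) AE_iff_measurable) auto
    moreover have "0 < emeasure lborel (ball 0 1 :: (real^'m^'m) set)"
      using emeasure_lborel_ball_finite[of "0 :: real^'m^'m" 1] content_ball_pos[of 1 "0 :: real^'m^'m"]
      by (simp add: emeasure_eq_ennreal_measure less_top)
    ultimately show False by simp
  qed
  have "radial_det_moment TYPE('m) CARD('n) ?F * ?I = (\<integral>\<^sup>+p. ?F (p \<bullet> p) \<partial>?E)"
    using nn_integral_matrix_quotient[of "\<lambda>_::real^'n^'m. 1" ?F] by simp
  also have "\<dots> = emeasure ?E (ball 0 1)"
    by (simp add: ball)
  also have "\<dots> < \<infinity>"
    by (rule emeasure_lborel_ball_finite)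
  finally show ?thesis
    using nonzero by (auto simp: ennreal_mult_less_top less_top)
qed

section \<open>Splitting the columns\<close>

lemma borel_measurable_select_columns [measurable (raw)]:
  fixes f :: "'a \<Rightarrow> real^'k^'m" and p :: "'j::finite \<Rightarrow> 'k"
  assumes "f \<in> borel_measurable M"
  shows "(\<lambda>x. select_columns p (f x)) \<in> borel_measurable M"
  unfolding select_columns_def
  by (rule borel_measurable_continuous_on[OF _ assms]) (intro continuous_intros)

text \<open>
  Inverse of \<open>A \<mapsto> (select_columns p A, select_columns q A)\<close> when \<open>p\<close> and \<open>q\<close> are injective with
  complementary ranges.
\<close>

definition merge_columns ::
    "('j \<Rightarrow> 'k) \<Rightarrow> ('n \<Rightarrow> 'k) \<Rightarrow> real^'j^'m \<Rightarrow> real^'n^'m \<Rightarrow> real^'k^'m" where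
  "merge_columns p q U V =
    (\<chi> i k. if k \<in> range p then U $ i $ inv p k else V $ i $ inv q k)"

lemma distr_lborel_select_columns:
  fixes p :: "'j::finite \<Rightarrow> 'k::finite" and q :: "'n::finite \<Rightarrow> 'k"
  assumes p: "inj p" and q: "inj q" and pq: "range q = - range p"
  shows "distr lborel borel (\<lambda>A :: real^'k^'m. (select_columns p A, select_columns q A)) = lborel"
proof (rule distr_lborel_permute_Basis)
  let ?T = "\<lambda>A :: real^'k^'m. (select_columns p A, select_columns q A)"
  let ?g = "\<lambda>x :: (real^'j^'m) \<times> (real^'n^'m). merge_columns p q (fst x) (snd x)"
  have disj: "p j \<noteq> q l" "q l \<noteq> p j" "q l \<notin> range p" for j l
    using pq by (metis ComplD rangeI)+
  have pq_cases: "(\<exists>j. k = p j) \<or> (\<exists>l. k = q l)" for k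
    using pq by (metis ComplI imageE)
  have T_axis: "?T (axis i (axis (p j) 1)) = (axis i (axis j 1), 0)"
    "?T (axis i (axis (q l) 1)) = (0, axis i (axis l 1))" for i j l
    using p q disj by (auto simp: select_columns_def vec_eq_iff axis_def inj_eq)
  have Tg: "?T (?g x) = x" for x
    using p q disj by (auto simp: merge_columns_def select_columns_def vec_eq_iff prod_eq_iff)
  have gT: "?g (?T A) = A" for A :: "real^'k^'m"
  proof -
    have "?g (?T A) $ i $ k = A $ i $ k" for i k
      using pq_cases[of k] p q disj by (auto simp: merge_columns_def select_columns_def)
    then show ?thesis by (simp add: vec_eq_iff)
  qed
  have T_Basis: "?T b \<in> Basis" if "b \<in> Basis" for b
  proof -
    obtain i k where b: "b = axis i (axis k 1)"
      using \<open>b \<in> Basis\<close> by (rule matrix_Basis_cases)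
    show ?thesis
      using pq_cases[of k] by (auto simp: b T_axis Basis_prod_def simp del: prod.inject)
  qed
  have g_axis: "merge_columns p q (axis i (axis j 1)) 0 = axis i (axis (p j) 1)"
    "merge_columns p q 0 (axis i (axis l 1)) = axis i (axis (q l) 1)" for i :: 'm and j l
    using gT[of "axis i (axis (p j) 1)"] gT[of "axis i (axis (q l) 1)"] by (simp_all only: T_axis fst_conv snd_conv)
  have g_Basis: "?g b \<in> Basis" if "b \<in> Basis" for b
  proof -
    from that consider U where "b = (U, 0)" "U \<in> Basis" | V where "b = (0, V)" "V \<in> Basis"
      by (auto simp: Basis_prod_def)
    then show ?thesis
      by cases (auto elim!: matrix_Basis_cases simp: g_axis)
  qed
  show "bij_betw ?g Basis Basis"
    by (rule bij_betwI[where g = ?T]) (use T_Basis g_Basis Tg gT in blast)+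
  show "?T A \<bullet> b = A \<bullet> ?g b" if "b \<in> Basis" for A b
  proof -
    from that consider U where "b = (U, 0)" "U \<in> Basis" | V where "b = (0, V)" "V \<in> Basis"
      by (auto simp: Basis_prod_def)
    then show ?thesis
      by cases (auto elim!: matrix_Basis_cases simp: g_axis inner_axis,
         auto simp: select_columns_def)
  qed
qed measurable

lemma inner_select_columns:
  fixes A :: "real^'k^'m" and p :: "'j::finite \<Rightarrow> 'k" and q :: "'n::finite \<Rightarrow> 'k"
  assumes "inj p" "inj q" "range q = - range p"
  shows "select_columns p A \<bullet> select_columns p A + select_columns q A \<bullet> select_columns q A = A \<bullet> A"
proof -
  have "(\<Sum>k\<in>UNIV. A$i$k * A$i$k) = (\<Sum>j\<in>UNIV. A$i$p j * A$i$p j) + (\<Sum>l\<in>UNIV. A$i$q l * A$i$q l)" for i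
  proof -
    have "(\<Sum>k\<in>UNIV. A$i$k * A$i$k) = (\<Sum>k\<in>range p. A$i$k * A$i$k) + (\<Sum>k\<in>range q. A$i$k * A$i$k)"
      unfolding assms(3) by (subst sum.union_disjoint[symmetric]) (auto simp: Compl_partition)
    then show ?thesis
      by (simp add: sum.reindex assms(1,2))
  qed
  then show ?thesis
    by (simp add: inner_vec_def select_columns_def sum.distrib)
qed

section \<open>The law of the matrix quotient\<close>

lemma nn_integral_gram_weight:
  obtains r where "0 < r" "(\<integral>\<^sup>+Z. ennreal (gram_weight (Z :: real^'n^'m)) \<partial>lborel) = ennreal r"
proof -
  let ?I = "\<integral>\<^sup>+Z. ennreal (gram_weight (Z :: real^'n^'m)) \<partial>lborel"
  have "?I \<noteq> 0"
  proof
    assume "?I = 0"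
    then have "AE Z in lborel. ennreal (gram_weight (Z :: real^'n^'m)) = 0"
      by (subst (asm) nn_integral_0_iff_AE) auto
    then have "AE Z in (lborel :: (real^'n^'m) measure). \<not> True"
      by eventually_elim (metis ennreal_eq_0_iff gram_weight_pos not_le)
    then have "(UNIV :: (real^'n^'m) set) \<in> null_sets lborel"
      by (subst (asm) AE_iff_null) auto
    then show False
      by auto
  qed
  with nn_integral_gram_weight_finite[where 'n='n and 'm='m] show ?thesis
    using that by (cases ?I) auto
qed

text \<open>
  The product formula shows that the law of the quotient is a multiple of the universal weight. As a
  probability law it has total mass 1, which determines the multiple whatever the profile is.
\<close>

lemma distributed_matrix_quotient:
  fixes f :: "real \<Rightarrow> real" and A :: "'w \<Rightarrow> real^'k^'m" and p :: "'m \<Rightarrow> 'k" and q :: "'n::finite \<Rightarrow> 'k"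
  assumes f: "set_borel_measurable borel {0<..} f"
    and M: "prob_space M"
    and A: "distributed M lborel A (\<lambda>a. ennreal (f (trace (a ** transpose a))))"
    and p: "inj p" and q: "inj q" and pq: "range q = - range p"
    and r: "0 < r" "(\<integral>\<^sup>+Z. ennreal (gram_weight (Z :: real^'n^'m)) \<partial>lborel) = ennreal r"
  shows "distributed M lborel
    (\<lambda>\<omega>. matrix_inv (select_columns p (A \<omega>)) ** select_columns q (A \<omega>))
    (\<lambda>Z. ennreal (gram_weight Z / r))"
proof -
  interpret prob_space M by (rule M)
  define Q where "Q a = matrix_inv (select_columns p a) ** select_columns q a" for a :: "real^'k^'m"
  \<comment> \<open>Cutting \<open>f\<close> off outside the positive reals makes it measurable and changes the density only at the zero matrix.\<close>
  define F where "F u = ennreal (indicator {0<..} u * f u)" for u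
  define \<kappa> where "\<kappa> = radial_det_moment TYPE('m) CARD('n) F"
  have [measurable]: "Q \<in> borel_measurable borel"
    unfolding Q_def[abs_def] by measurable
  have [measurable]: "F \<in> borel_measurable borel"
    unfolding F_def[abs_def] using f by (simp add: set_borel_measurable_def)
  have [measurable]: "A \<in> borel_measurable M"
    using distributed_measurable[OF A] by simp
  have dens: "AE a in lborel. ennreal (f (trace (a ** transpose a))) = F (a \<bullet> (a :: real^'k^'m))"
    using AE_lborel_singleton[of 0]
    by eventually_elim (simp add: F_def flip: inner_matrix_eq_trace)
  have law: "emeasure (distr M lborel (\<lambda>\<omega>. Q (A \<omega>))) S =
      \<kappa> * (\<integral>\<^sup>+Z. indicator S Z * ennreal (gram_weight Z) \<partial>lborel)"
    if [measurable]: "S \<in> sets borel" for S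
  proof -
    have [measurable]: "Q -` S \<in> sets borel"
      using measurable_sets[of Q borel borel S] by simp
    have pair_meas: "(\<lambda>x :: (real^'m^'m) \<times> (real^'n^'m).
        indicator S (matrix_inv (fst x) ** snd x) * F (x \<bullet> x)) \<in> borel_measurable borel"
      unfolding borel_prod[symmetric] inner_prod_def by measurable
    have "distr M lborel (\<lambda>\<omega>. Q (A \<omega>)) = distr (distr M lborel A) lborel Q"
      by (subst distr_distr) (auto simp: comp_def)
    then have "emeasure (distr M lborel (\<lambda>\<omega>. Q (A \<omega>))) S =
        emeasure (density lborel (\<lambda>a. ennreal (f (trace (a ** transpose a))))) (Q -` S)"
      by (simp add: emeasure_distr distributed_distr_eq_density[OF A])
    also have "density lborel (\<lambda>a. ennreal (f (trace (a ** transpose a)))) =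
        density lborel (\<lambda>a :: real^'k^'m. F (a \<bullet> a))"
      using dens distributed_borel_measurable[OF A] by (intro density_cong) auto
    also have "emeasure \<dots> (Q -` S) = (\<integral>\<^sup>+a. indicator S (Q a) * F (a \<bullet> a) \<partial>lborel)"
      by (subst emeasure_density) (auto intro!: nn_integral_cong simp: indicator_def)
    also have "\<dots> = (\<integral>\<^sup>+a. (\<lambda>x. indicator S (matrix_inv (fst x) ** snd x) * F (x \<bullet> x))
        (select_columns p (a :: real^'k^'m), select_columns q a) \<partial>lborel)"
      by (simp add: Q_def inner_select_columns[OF p q pq])
    also have "\<dots> = (\<integral>\<^sup>+x. indicator S (matrix_inv (fst x) ** snd x) * F (x \<bullet> x)
        \<partial>distr lborel borel (\<lambda>a :: real^'k^'m. (select_columns p a, select_columns q a)))"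
      by (rule nn_integral_distr[symmetric]) (simp_all add: pair_meas)
    also have "\<dots> = \<kappa> * (\<integral>\<^sup>+Z. indicator S Z * ennreal (gram_weight Z) \<partial>lborel)"
      unfolding distr_lborel_select_columns[OF p q pq] \<kappa>_def
      by (rule nn_integral_matrix_quotient) measurable
    finally show ?thesis .
  qed
  interpret QA: prob_space "distr M lborel (\<lambda>\<omega>. Q (A \<omega>))"
    by (rule prob_space_distr) simp
  have "\<kappa> * ennreal r = 1"
    using law[of UNIV] QA.emeasure_space_1 r(2) by simp
  then have "\<kappa> * ennreal r * ennreal (1 / r) = ennreal (1 / r)"
    by simp
  then have \<kappa>: "\<kappa> = ennreal (1 / r)"
    using r(1) by (simp add: mult.assoc flip: ennreal_mult)
  have "distr M lborel (\<lambda>\<omega>. Q (A \<omega>)) = density lborel (\<lambda>Z. ennreal (gram_weight Z / r))"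
  proof (rule measure_eqI)
    fix S assume "S \<in> sets (distr M lborel (\<lambda>\<omega>. Q (A \<omega>)))"
    then have [measurable]: "S \<in> sets borel" by simp
    have "emeasure (distr M lborel (\<lambda>\<omega>. Q (A \<omega>))) S =
        (\<integral>\<^sup>+Z. \<kappa> * (indicator S Z * ennreal (gram_weight Z)) \<partial>lborel)"
      by (simp add: law nn_integral_cmult)
    also have "\<dots> = (\<integral>\<^sup>+Z. ennreal (gram_weight Z / r) * indicator S Z \<partial>lborel)"
      using r(1) by (intro nn_integral_cong)
        (auto simp: \<kappa> indicator_def gram_weight_pos less_imp_le simp flip: ennreal_mult)
    also have "\<dots> = emeasure (density lborel (\<lambda>Z. ennreal (gram_weight Z / r))) S"
      by (simp add: emeasure_density)
    finally show "emeasure (distr M lborel (\<lambda>\<omega>. Q (A \<omega>))) S =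
        emeasure (density lborel (\<lambda>Z. ennreal (gram_weight Z / r))) S" .
  qed simp
  then show ?thesis
    unfolding distributed_def by (simp add: Q_def[symmetric])
qed

theorem theorem2p1:
  fixes P :: "real \<Rightarrow> real ^ 'n ^ 'm \<Rightarrow> real"
  defines "P \<equiv> \<lambda>C Z. C / det (mat 1 + Z ** transpose Z) powr (real (CARD('m) + CARD('n)) / 2)"
  shows "\<exists>C::real.
    (\<integral>\<^sup>+Z. ennreal (P C Z) \<partial>lborel) = 1 \<and>
    (\<forall>(f :: real \<Rightarrow> real) (M :: 'w measure) (A :: 'w \<Rightarrow> real ^ 'k ^ 'm)
        (p :: 'm \<Rightarrow> 'k) (q :: 'n \<Rightarrow> 'k).
       admissible_profile (CARD('m) * (CARD('m) + CARD('n))) f \<longrightarrow>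
       prob_space M \<longrightarrow>
       distributed M lborel A (\<lambda>a. ennreal (f (trace (a ** transpose a)))) \<longrightarrow>
       inj p \<longrightarrow> inj q \<longrightarrow> range q = - range p \<longrightarrow>
       distributed M lborel
         (\<lambda>\<omega>. matrix_inv (select_columns p (A \<omega>)) ** select_columns q (A \<omega>))
         (\<lambda>Z. ennreal (P C Z)))"
proof -
  obtain r where r: "0 < r" "(\<integral>\<^sup>+Z. ennreal (gram_weight (Z :: real^'n^'m)) \<partial>lborel) = ennreal r"
    by (rule nn_integral_gram_weight)
  have P: "P (1 / r) Z = gram_weight Z / r" for Z
    by (simp add: P_def gram_weight_def)
  have "(\<integral>\<^sup>+Z. ennreal (P (1 / r) Z) \<partial>lborel) =
      (\<integral>\<^sup>+Z. ennreal (1 / r) * ennreal (gram_weight (Z :: real^'n^'m)) \<partial>lborel)"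
    using r(1) by (simp add: P gram_weight_pos less_imp_le flip: ennreal_mult)
  also have "\<dots> = 1"
    using r(1) by (simp add: nn_integral_cmult r(2) flip: ennreal_mult)
  finally have "(\<integral>\<^sup>+Z. ennreal (P (1 / r) Z) \<partial>lborel) = 1" .
  then show ?thesis
    by (intro exI[of _ "1 / r"] conjI allI impI)
       (auto simp: P admissible_profile_def intro!: distributed_matrix_quotient r)
qed

end
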